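(* Let $R$ be an infinite commutative ring with nonzero identity and let $n\ge 1$ be an integer. Then $\alpha(TD(R,n))=\infty$.
   Context: For a commutative ring $R$ with nonzero identity and an integer $n\ge1$, $TD(R,n)$ is the simple graph with vertex set $R^n\setminus\{(0,\ldots,0)\}$ in which two distinct vertices $\mathbf{x},\mathbf{y}$ are adjacent if and only if $\mathbf{x}\cdot\mathbf{y}=\sum_{i=1}^n x_iy_i=0$ in $R$. $\alpha(G)$ is the independence number of $G$: the maximum size of a set of pairwise non-adjacent vertices; $\alpha(G)=\infty$ means that this is not finite. *)

theory Defs
  imports Jordan_Normal_Form.Matrix "HOL-Library.Extended_Nat"
begin

text \<open>A simple graph is a vertex set together with a set of two-element sets of vertices.
  Vertex sets may be infinite.\<close>

record 'v sgraph =
  verts :: "'v set"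
  edges :: "'v set set"

definition simple_graph :: "'v sgraph \<Rightarrow> bool" where
  "simple_graph G \<longleftrightarrow> (\<forall>e\<in>edges G. e \<subseteq> verts G \<and> card e = 2)"

definition adjacent :: "'v sgraph \<Rightarrow> 'v \<Rightarrow> 'v \<Rightarrow> bool" where
  "adjacent G u v \<longleftrightarrow> {u, v} \<in> edges G"

definition independent_set :: "'v sgraph \<Rightarrow> 'v set \<Rightarrow> bool" where
  "independent_set G S \<longleftrightarrow>
     S \<subseteq> verts G \<and> (\<forall>u\<in>S. \<forall>v\<in>S. u \<noteq> v \<longrightarrow> \<not> adjacent G u v)"

definition set_size :: "'v set \<Rightarrow> enat" where
  "set_size S = (if finite S then enat (card S) else \<infinity>)"

text \<open>The supremum is a maximum if it is finite. It is \<open>\<infinity>\<close> exactly if there is an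
  infinite independent set or there are finite independent sets of unbounded size.\<close>

definition independence_number :: "'v sgraph \<Rightarrow> enat" where
  "independence_number G = (SUP S \<in> {S. independent_set G S}. set_size S)"

text \<open>The ring is the whole type \<open>'a\<close>, and \<open>R\<^sup>n\<close> is \<open>carrier_vec n\<close>, the vectors of dimension
  \<open>n\<close> with entries indexed by \<open>0, \<dots>, n - 1\<close>.\<close>

definition TD :: "nat \<Rightarrow> 'a::comm_ring_1 vec sgraph" where
  "TD n = \<lparr> verts = carrier_vec n - {0\<^sub>v n},
            edges = {{x, y} | x y. x \<in> carrier_vec n - {0\<^sub>v n} \<and> y \<in> carrier_vec n - {0\<^sub>v n}
                               \<and> x \<noteq> y \<and> x \<bullet> y = 0} \<rparr>"

lemma simple_graph_TD: "simple_graph (TD n)"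
  by (auto simp: simple_graph_def TD_def)

lemma adjacent_TD_iff:
  assumes "x \<in> verts (TD n)" "y \<in> verts (TD n)"
  shows "adjacent (TD n) x y \<longleftrightarrow> x \<noteq> y \<and> x \<bullet> y = 0"
  using assms comm_scalar_prod[of y n x]
  by (auto simp: adjacent_def TD_def doubleton_eq_iff)

end

theory Submission
  imports Defs "HOL-Library.Ramsey"
begin

text \<open>
  The map \<^term>\<open>\<lambda>a. a \<cdot>\<^sub>v unit_vec n 0\<close> turns the product of two ring elements into the
  scalar product of their images, so it suffices to find an infinite set of nonzero elements
  of \<open>R\<close> in which distinct elements have nonzero products. Ramsey's theorem applied to the
  nonzero elements gives either such a set or an infinite set \<open>C\<close> in which distinct elements
  have product zero. In the second case the translate \<open>1 + C\<close> has the required property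
  (\<open>nonzero_products_translate\<close>).
\<close>

text \<open>If \<open>(1 + c) * (1 + d) = 0\<close>, then \<open>1 + c + d = 0\<close> because \<open>c * d = 0\<close>. A third element
  \<open>e\<close> of \<open>C\<close> annihilates \<open>c\<close> and \<open>d\<close>, so multiplication by \<open>e\<close> yields \<open>e = 0\<close>. The case
  \<open>1 + c = 0\<close> is excluded in the same way.\<close>

lemma nonzero_products_translate:
  fixes C :: "'a::comm_ring_1 set"
  assumes inf: "infinite C" and nz: "0 \<notin> C"
    and zero: "\<And>c d. c \<in> C \<Longrightarrow> d \<in> C \<Longrightarrow> c \<noteq> d \<Longrightarrow> c * d = 0"
  shows "0 \<notin> (+) 1 ` C"
    and "\<And>x y. x \<in> (+) 1 ` C \<Longrightarrow> y \<in> (+) 1 ` C \<Longrightarrow> x \<noteq> y \<Longrightarrow> x * y \<noteq> 0"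
proof -
  have third: "\<exists>e\<in>C. e \<noteq> c \<and> e \<noteq> d" for c d
  proof -
    have "infinite (C - {c, d})"
      using inf by simp
    then have "C - {c, d} \<noteq> {}"
      by (metis finite.emptyI)
    then show ?thesis
      by blast
  qed
  show "0 \<notin> (+) 1 ` C"
  proof
    assume "0 \<in> (+) 1 ` C"
    then obtain c where c: "c \<in> C" "1 + c = 0"
      by (metis imageE)
    obtain e where e: "e \<in> C" "e \<noteq> c"
      using third by blast
    have "e = e * (1 + c) - e * c"
      by (simp add: algebra_simps)
    also have "\<dots> = 0"
      using c e zero by simp
    finally show False
      using e nz by simp
  qed
  fix x y
  assume "x \<in> (+) 1 ` C" "y \<in> (+) 1 ` C" "x \<noteq> y"
  then obtain c d where cd: "c \<in> C" "d \<in> C" "c \<noteq> d" "x = 1 + c" "y = 1 + d"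
    by blast
  show "x * y \<noteq> 0"
  proof
    assume xy: "x * y = 0"
    obtain e where e: "e \<in> C" "e \<noteq> c" "e \<noteq> d"
      using third by blast
    have "e = e * (x * y) - e * c * (1 + d) - e * d"
      by (simp add: cd algebra_simps)
    also have "\<dots> = 0"
      using cd e zero xy by simp
    finally show False
      using e nz by simp
  qed
qed

lemma infinite_nonzero_products:
  assumes "infinite (UNIV :: 'a::comm_ring_1 set)"
  obtains S :: "'a::comm_ring_1 set" where "infinite S" "0 \<notin> S"
    "\<And>x y. x \<in> S \<Longrightarrow> y \<in> S \<Longrightarrow> x \<noteq> y \<Longrightarrow> x * y \<noteq> 0"
proof -
  define colour :: "'a set \<Rightarrow> nat"
    where "colour e = (if \<exists>x y. e = {x, y} \<and> x \<noteq> y \<and> x * y = 0 then 1 else 0)" for e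
  have colour: "colour {x, y} = (if x * y = 0 then 1 else 0)" if "x \<noteq> y" for x y
    using that by (auto simp: colour_def doubleton_eq_iff mult.commute)
  have "infinite (UNIV - {0 :: 'a})"
    using assms by simp
  moreover have "\<forall>x\<in>UNIV - {0}. \<forall>y\<in>UNIV - {0}. x \<noteq> y \<longrightarrow> colour {x, y} < 2"
    by (simp add: colour_def)
  ultimately obtain C t where C: "C \<subseteq> UNIV - {0}" "infinite C"
      and t: "\<forall>x\<in>C. \<forall>y\<in>C. x \<noteq> y \<longrightarrow> colour {x, y} = t"
    using Ramsey2[of "UNIV - {0 :: 'a}" colour 2] by blast
  show thesis
  proof (cases "t = 1")
    case True
    have zero: "c * d = 0" if "c \<in> C" "d \<in> C" "c \<noteq> d" for c d
      using t that colour True by (metis zero_neq_one)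
    have nz: "0 \<notin> C"
      using C(1) by blast
    have inf: "infinite ((+) 1 ` C)"
      using C(2) by (simp add: finite_image_iff)
    show thesis
      by (rule that[OF inf nonzero_products_translate[OF C(2) nz zero]])
  next
    case False
    have "c * d \<noteq> 0" if "c \<in> C" "d \<in> C" "c \<noteq> d" for c d
      using t that colour False by metis
    then show thesis
      using C that[of C] by blast
  qed
qed

lemma scalar_prod_smult_unit_vec:
  fixes a b :: "'a::comm_ring_1"
  assumes "i < n"
  shows "(a \<cdot>\<^sub>v unit_vec n i) \<bullet> (b \<cdot>\<^sub>v unit_vec n i) = a * b"
  using assms by simp

lemma smult_unit_vec_eq_iff:
  fixes a b :: "'a::comm_ring_1"
  assumes "i < n"
  shows "a \<cdot>\<^sub>v unit_vec n i = b \<cdot>\<^sub>v unit_vec n i \<longleftrightarrow> a = b"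
  using assms by (metis index_smult_vec(1) index_unit_vec(1,3) mult.right_neutral)

lemma independence_number_eq_infinity:
  assumes "independent_set G S" "infinite S"
  shows "independence_number G = \<infinity>"
proof -
  have "set_size S \<le> independence_number G"
    unfolding independence_number_def using assms(1) by (intro SUP_upper) simp
  then show ?thesis
    using assms(2) by (simp add: set_size_def)
qed

theorem theorem4p8:
  fixes n :: nat
  assumes "infinite (UNIV :: 'a::comm_ring_1 set)"
    and "n \<ge> 1"
  shows "independence_number (TD n :: 'a vec sgraph) = \<infinity>"
proof -
  obtain S :: "'a set" where S: "infinite S" "0 \<notin> S"
      "\<And>x y. x \<in> S \<Longrightarrow> y \<in> S \<Longrightarrow> x \<noteq> y \<Longrightarrow> x * y \<noteq> 0"
    using infinite_nonzero_products[OF assms(1)] by blast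
  have n: "0 < n"
    using assms(2) by simp
  define f :: "'a \<Rightarrow> 'a vec" where "f a = a \<cdot>\<^sub>v unit_vec n 0" for a
  have prod: "f a \<bullet> f b = a * b" for a b
    unfolding f_def by (rule scalar_prod_smult_unit_vec[OF n])
  have inj: "f a = f b \<longleftrightarrow> a = b" for a b
    unfolding f_def by (rule smult_unit_vec_eq_iff[OF n])
  have zero: "f 0 = 0\<^sub>v n"
    by (auto simp: f_def)
  have vert: "f a \<in> verts (TD n)" if "a \<in> S" for a
  proof -
    have "f a \<in> carrier_vec n"
      by (simp add: f_def)
    moreover have "f a \<noteq> 0\<^sub>v n"
      using that S(2) inj[of a 0] zero by auto
    ultimately show ?thesis
      by (simp add: TD_def)
  qed
  have "independent_set (TD n) (f ` S)"
    using vert S(3) by (auto simp: independent_set_def adjacent_TD_iff prod)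
  moreover have "infinite (f ` S)"
    using S(1) inj by (simp add: finite_image_iff inj_on_def)
  ultimately show ?thesis
    by (rule independence_number_eq_infinity)
qed

end
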